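(* Let $L_s=-\partial^2+u_s$ be an algebro-geometric Schrödinger operator with spectral curve $\Gamma_s$. Let $\partial-\phi_s$ be the intrinsic right factor of $L_s-\lambda$ in $K(\Gamma_s)[\partial]$. A nonzero solution $\Psi_s$ of $(L_s-\lambda)\Psi=0$ defined by the differential relation $\partial(\Psi_s)=\phi_s\Psi_s$ is transcendental over $K(\Gamma_s)$, and the field of constants of $K(\Gamma_s)\langle\Psi_s\rangle$ equals the field of constants of $K(\Gamma_s)$.
   Context: $(\Sigma,\partial)$ is a differential field of characteristic zero whose field of constants $C$ is algebraically closed. An operator $L\in\Sigma[\partial]\setminus C[\partial]$ of order $n$ is algebro-geometric if some $P\in\Sigma[\partial]$ of order relatively prime to $n$ satisfies $[L,P]=0$. Let $L_s=-\partial^2+u_s$ with $u_s\in\Sigma\setminus C$ be algebro-geometric. Then there is a unique monic operator $A_{2s+1}$ of minimal order $2s+1$ (minimal among operators of the centralizer not in $C[L_s]$) such that the centralizer of $L_s$ in $\Sigma[\partial]$ is $C[L_s,A_{2s+1}]$ and $A_{2s+1}^2+R_{2s+1}(L_s)=0$ with $R_{2s+1}\in C[\lambda]$ of degree $2s+1$; $A_{2s+1}$ is the partner of $L_s$ and $s$ the level. $K=C\langle u_s\rangle$ is the differential subfield of $\Sigma$ generated by $C$ and $u_s$; $L_s,A_{2s+1}\in K[\partial]$. Let $\lambda,\mu$ be algebraic indeterminates over $K$ with $\partial\lambda=\partial\mu=0$. Put $f_s=\mu^2+R_{2s+1}(\lambda)$; the spectral curve $\Gamma_s\subset C^2$ is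 $f_s=0$. $K(\Gamma_s)$ is the fraction field of the domain $K[\lambda,\mu]/(f_s)$; its derivation (also written $\partial$) is induced by $\partial$ on $K[\lambda,\mu]$ acting on coefficients. The monic greatest common right divisor of $L_s-\lambda$ and $A_{2s+1}-\mu$ in $K(\Gamma_s)[\partial]$ has order one; it is written $\partial-\phi_s$ with $\phi_s\in K(\Gamma_s)$ and called the intrinsic right factor of $L_s-\lambda$. Solutions are taken in a differential closure of $K(\Gamma_s)$; $\langle\,\cdot\,\rangle$ denotes the generated differential field extension. *)

theory Defs
  imports
    "HOL-Computational_Algebra.Polynomial"
    "HOL-Library.Poly_Mapping"
begin

section \<open>Differential fields\<close>

definition derivation :: "('a::field \<Rightarrow> 'a) \<Rightarrow> bool" where
  "derivation d \<longleftrightarrow>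
     (\<forall>x y. d (x + y) = d x + d y) \<and> (\<forall>x y. d (x * y) = d x * y + x * d y)"

definition constants :: "('a::field \<Rightarrow> 'a) \<Rightarrow> 'a set" where
  "constants d = {x. d x = 0}"

definition differential_subfield :: "('a::field \<Rightarrow> 'a) \<Rightarrow> 'a set \<Rightarrow> bool" where
  "differential_subfield d M \<longleftrightarrow>
     0 \<in> M \<and> 1 \<in> M \<and>
     (\<forall>x\<in>M. \<forall>y\<in>M. x + y \<in> M \<and> x - y \<in> M \<and> x * y \<in> M) \<and>
     (\<forall>x\<in>M. inverse x \<in> M) \<and>
     (\<forall>x\<in>M. d x \<in> M)"

text \<open>
  The differential field generated by \<open>S\<close> is written \<open>differential_subfield d hull S\<close>.
\<close>

definition polys_over :: "'a::zero set \<Rightarrow> 'a poly set" where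
  "polys_over M = {p. \<forall>i. coeff p i \<in> M}"

definition algebraically_closed_on :: "'a::field set \<Rightarrow> bool" where
  "algebraically_closed_on M \<longleftrightarrow>
     (\<forall>p\<in>polys_over M. degree p > 0 \<longrightarrow> (\<exists>x\<in>M. poly p x = 0))"

definition transcendental_over :: "'a::field set \<Rightarrow> 'a \<Rightarrow> bool" where
  "transcendental_over M x \<longleftrightarrow> (\<forall>p\<in>polys_over M. poly p x = 0 \<longrightarrow> p = 0)"

definition field_hom_on :: "'a::field set \<Rightarrow> ('a \<Rightarrow> 'b::field) \<Rightarrow> bool" where
  "field_hom_on M h \<longleftrightarrow>
     h 1 = 1 \<and> (\<forall>x\<in>M. \<forall>y\<in>M. h (x + y) = h x + h y \<and> h (x * y) = h x * h y)"


section \<open>Differential operators\<close>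

text \<open>
  An operator \<open>\<Sum>i. a\<^sub>i \<partial>\<^sup>i\<close> is represented by the polynomial with coefficients \<open>a\<^sub>i\<close>, so
  that its order is \<^const>\<open>degree\<close>.  Addition is that of polynomials; the product is not the
  commutative product of the type \<open>'a poly\<close> but \<open>dop_mult d\<close>, which is determined by
  \<open>\<partial> a = a \<partial> + d a\<close>.
\<close>

definition dop_shift :: "('a::field \<Rightarrow> 'a) \<Rightarrow> 'a poly \<Rightarrow> 'a poly" where
  \<comment> \<open>left multiplication by \<open>\<partial>\<close>\<close>
  "dop_shift d q = pCons 0 q + map_poly d q"

definition dop_mult :: "('a::field \<Rightarrow> 'a) \<Rightarrow> 'a poly \<Rightarrow> 'a poly \<Rightarrow> 'a poly" where
  "dop_mult d p q = (\<Sum>i\<le>degree p. smult (coeff p i) ((dop_shift d ^^ i) q))"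

definition dop_power :: "('a::field \<Rightarrow> 'a) \<Rightarrow> 'a poly \<Rightarrow> nat \<Rightarrow> 'a poly" where
  "dop_power d p n = (dop_mult d p ^^ n) 1"

definition dop_eval :: "('a::field \<Rightarrow> 'a) \<Rightarrow> 'a poly \<Rightarrow> 'a poly \<Rightarrow> 'a poly" where
  \<comment> \<open>the operator \<open>R(L)\<close> for a polynomial \<open>R\<close>\<close>
  "dop_eval d R L = (\<Sum>i\<le>degree R. smult (coeff R i) (dop_power d L i))"

definition dop_apply :: "('a::field \<Rightarrow> 'a) \<Rightarrow> 'a poly \<Rightarrow> 'a \<Rightarrow> 'a" where
  "dop_apply d p y = (\<Sum>i\<le>degree p. coeff p i * (d ^^ i) y)"

definition centralizer :: "('a::field \<Rightarrow> 'a) \<Rightarrow> 'a poly \<Rightarrow> 'a poly set" where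
  "centralizer d L = {P. dop_mult d L P = dop_mult d P L}"

text \<open>
  With \<open>C = constants d\<close>, the set \<open>dop_algebra d S\<close> is the \<open>C\<close>-algebra of operators generated
  by \<open>S\<close>; thus \<open>C[L]\<close> is \<open>dop_algebra d {L}\<close> and \<open>C[L, A]\<close> is \<open>dop_algebra d {L, A}\<close>.
\<close>

inductive_set dop_algebra :: "('a::field \<Rightarrow> 'a) \<Rightarrow> 'a poly set \<Rightarrow> 'a poly set"
  for d :: "'a \<Rightarrow> 'a" and S :: "'a poly set" where
  const: "c \<in> constants d \<Longrightarrow> [:c:] \<in> dop_algebra d S"
| gen: "P \<in> S \<Longrightarrow> P \<in> dop_algebra d S"
| add: "P \<in> dop_algebra d S \<Longrightarrow> Q \<in> dop_algebra d S \<Longrightarrow> P + Q \<in> dop_algebra d S"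
| mult: "P \<in> dop_algebra d S \<Longrightarrow> Q \<in> dop_algebra d S \<Longrightarrow> dop_mult d P Q \<in> dop_algebra d S"

definition dop_right_dvd ::
  "('a::field \<Rightarrow> 'a) \<Rightarrow> 'a set \<Rightarrow> 'a poly \<Rightarrow> 'a poly \<Rightarrow> bool" where
  \<comment> \<open>\<open>G\<close> is a right divisor of \<open>P\<close> in \<open>F[\<partial>]\<close>\<close>
  "dop_right_dvd d F G P \<longleftrightarrow> (\<exists>B\<in>polys_over F. P = dop_mult d B G)"

definition monic_gcrd ::
  "('a::field \<Rightarrow> 'a) \<Rightarrow> 'a set \<Rightarrow> 'a poly \<Rightarrow> 'a poly \<Rightarrow> 'a poly \<Rightarrow> bool" where
  "monic_gcrd d F G P Q \<longleftrightarrow>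
     G \<in> polys_over F \<and> lead_coeff G = 1 \<and>
     dop_right_dvd d F G P \<and> dop_right_dvd d F G Q \<and>
     (\<forall>H\<in>polys_over F. dop_right_dvd d F H P \<and> dop_right_dvd d F H Q \<longrightarrow>
        dop_right_dvd d F H G)"


section \<open>Algebro-geometric operators and partners\<close>

definition algebro_geometric :: "('a::field \<Rightarrow> 'a) \<Rightarrow> 'a poly \<Rightarrow> bool" where
  "algebro_geometric d L \<longleftrightarrow>
     L \<notin> polys_over (constants d) \<and>
     (\<exists>P. P \<noteq> 0 \<and> coprime (degree P) (degree L) \<and> P \<in> centralizer d L)"

definition schroedinger :: "'a::field \<Rightarrow> 'a poly" where
  "schroedinger u = [:u, 0, -1:]"

text \<open>
  \<open>partner d L s A R\<close>: \<open>A\<close> is the partner of \<open>L\<close>, the level of \<open>L\<close> is \<open>s\<close>, and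
  \<open>A\<^sup>2 + R(L) = 0\<close>.
\<close>

definition partner ::
  "('a::field \<Rightarrow> 'a) \<Rightarrow> 'a poly \<Rightarrow> nat \<Rightarrow> 'a poly \<Rightarrow> 'a poly \<Rightarrow> bool" where
  "partner d L s A R \<longleftrightarrow>
     lead_coeff A = 1 \<and> degree A = 2 * s + 1 \<and>
     A \<in> centralizer d L - dop_algebra d {L} \<and>
     (\<forall>B \<in> centralizer d L - dop_algebra d {L}. degree A \<le> degree B) \<and>
     centralizer d L = dop_algebra d {L, A} \<and>
     R \<in> polys_over (constants d) \<and> degree R = 2 * s + 1 \<and>
     dop_mult d A A + dop_eval d R L = 0"


section \<open>The function field of the spectral curve\<close>

text \<open>
  Elements of \<open>K[\<lambda>, \<mu>]\<close> are polynomials in \<open>\<mu>\<close> whose coefficients are polynomials in \<open>\<lambda>\<close>,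
  i.e. members of \<open>polys_over (polys_over K)\<close>.
\<close>

definition spectral_poly :: "'a::field poly \<Rightarrow> 'a poly poly" where
  \<comment> \<open>\<open>\<mu>\<^sup>2 + R(\<lambda>)\<close>\<close>
  "spectral_poly R = [:R, 0, 1:]"

definition eval2 :: "('a::field \<Rightarrow> 'b::field) \<Rightarrow> 'b \<Rightarrow> 'b \<Rightarrow> 'a poly poly \<Rightarrow> 'b" where
  \<comment> \<open>the map \<open>K[\<lambda>, \<mu>] \<rightarrow> E\<close> that is \<open>emb\<close> on \<open>K\<close> and sends \<open>\<lambda>, \<mu>\<close> to \<open>lam, mu\<close>\<close>
  "eval2 emb lam mu g = poly (map_poly (\<lambda>p. poly (map_poly emb p) lam) g) mu"

text \<open>
  The quotient \<open>K[\<lambda>, \<mu>]/(f)\<close> depends on \<open>f\<close>, so its fraction field is not a type; it is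
  described by its defining property, and is placed inside an ambient field so that extensions
  of it can be formed.  The subset \<open>F\<close> of the ambient field is the fraction field of
  \<open>K[\<lambda>, \<mu>]/(f)\<close>: the map \<open>eval2 emb lam mu\<close> is a ring homomorphism on \<open>K[\<lambda>, \<mu>]\<close> with kernel
  the ideal generated by \<open>f\<close>, and \<open>F\<close> consists of the quotients of its values.
  Only the values of \<open>emb\<close> on \<open>K\<close> matter.
\<close>

definition curve_function_field ::
  "'a::field set \<Rightarrow> 'a poly poly \<Rightarrow> ('a \<Rightarrow> 'b::field) \<Rightarrow> 'b \<Rightarrow> 'b \<Rightarrow> 'b set \<Rightarrow> bool" where
  "curve_function_field K f emb lam mu F \<longleftrightarrow>
     field_hom_on K emb \<and>
     (\<forall>g\<in>polys_over (polys_over K).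
        eval2 emb lam mu g = 0 \<longleftrightarrow> (\<exists>h\<in>polys_over (polys_over K). g = f * h)) \<and>
     F = {eval2 emb lam mu g / eval2 emb lam mu h | g h.
            g \<in> polys_over (polys_over K) \<and> h \<in> polys_over (polys_over K) \<and>
            eval2 emb lam mu h \<noteq> 0}"


section \<open>Differential closure\<close>

text \<open>
  A differential polynomial in one indeterminate \<open>y\<close> is a polynomial in the variables
  \<open>y, y', y'', \<dots>\<close>, numbered by their order of differentiation.
\<close>

type_synonym 'a diffpoly = "(nat \<Rightarrow>\<^sub>0 nat) \<Rightarrow>\<^sub>0 'a"

definition diffpoly_eval :: "('a::field \<Rightarrow> 'a) \<Rightarrow> 'a diffpoly \<Rightarrow> 'a \<Rightarrow> 'a" where
  "diffpoly_eval d p y =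
     (\<Sum>m\<in>Poly_Mapping.keys p. Poly_Mapping.lookup p m *
        (\<Prod>i\<in>Poly_Mapping.keys m. (d ^^ i) y ^ Poly_Mapping.lookup m i))"

definition diffpoly_height :: "'a::zero diffpoly \<Rightarrow> nat" where
  \<comment> \<open>the order plus one; \<open>0\<close> for elements of the coefficient field\<close>
  "diffpoly_height p =
     (LEAST n. \<forall>m\<in>Poly_Mapping.keys p. Poly_Mapping.keys m \<subseteq> {..<n})"

definition diffpolys_over :: "'a::zero set \<Rightarrow> 'a diffpoly set" where
  "diffpolys_over M = {p. \<forall>m. Poly_Mapping.lookup p m \<in> M}"

text \<open>Blum's axioms for differentially closed fields of characteristic zero.\<close>

definition differentially_closed :: "('a::field_char_0 \<Rightarrow> 'a) \<Rightarrow> 'a set \<Rightarrow> bool" where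
  "differentially_closed d M \<longleftrightarrow>
     differential_subfield d M \<and>
     (\<forall>f\<in>diffpolys_over M. \<forall>g\<in>diffpolys_over M.
        g \<noteq> 0 \<and> diffpoly_height g < diffpoly_height f \<longrightarrow>
        (\<exists>y\<in>M. diffpoly_eval d f y = 0 \<and> diffpoly_eval d g y \<noteq> 0))"

text \<open>
  The whole type is a differential closure of its subset \<open>F\<close>: it is differentially closed and
  embeds over \<open>F\<close> into every differentially closed extension of \<open>F\<close>.  A definition cannot
  quantify over all extensions of \<open>F\<close>, but those inside the type suffice: a differential
  closure \<open>M\<close> of \<open>F\<close> embeds over \<open>F\<close> into the differentially closed whole type, and embeds
  over \<open>F\<close> into all other differentially closed extensions, so that embedding the whole type
  into \<open>M\<close> embeds it into all of them.
\<close>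

definition differential_closure :: "('a::field_char_0 \<Rightarrow> 'a) \<Rightarrow> 'a set \<Rightarrow> bool" where
  "differential_closure d F \<longleftrightarrow>
     differentially_closed d UNIV \<and> differential_subfield d F \<and>
     (\<forall>M. differentially_closed d M \<and> F \<subseteq> M \<longrightarrow>
        (\<exists>h. field_hom_on UNIV h \<and> (\<forall>x. h (d x) = d (h x)) \<and>
             (\<forall>x\<in>F. h x = x) \<and> range h \<subseteq> M))"

end

theory Submission
  imports Defs
begin

text \<open>
  The obstruction sits at infinity on the spectral curve.  Since \<open>\<mu>\<^sup>2 = - R(\<lambda>)\<close> with \<open>R\<close> of odd
  degree, there is a single point at infinity, and the order of a pole there is measured by the
  degree in \<open>\<lambda>\<close> of the norm \<open>p\<^sup>2 + R q\<^sup>2\<close> of \<open>p + q \<mu>\<close>.  The derivation acts on coefficients only, so it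
  does not increase pole orders; consequently a logarithmic derivative \<open>a' / a\<close> of a nonzero element
  \<open>a\<close> of the function field has no pole at infinity (\<open>log_derivative_no_pole\<close>).  On the other hand,
  \<open>\<Psi>' = \<phi> \<Psi>\<close> and \<open>L \<Psi> = \<lambda> \<Psi>\<close> give the Riccati equation \<open>\<phi>' + \<phi>\<^sup>2 = u - \<lambda>\<close>, whose right side has a double
  pole at infinity, so \<open>\<phi>\<close> must have a pole there (\<open>riccati_solution_pole\<close>).  Hence \<open>a' = m \<phi> a\<close> with
  \<open>m > 0\<close> has no nonzero solution \<open>a\<close> in the function field.

  The rest holds over every differential field \<open>F\<close> in which the equations \<open>a' = m \<phi> a\<close> have no nonzero
  solution.  Extend the derivation to \<open>F[Y]\<close> by \<open>Y' = \<phi> Y\<close>.  It is diagonal on monomials, and the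
  hypothesis says that its eigenvalues \<open>n \<phi>\<close> behave as distinct ones: every nonzero stable subspace
  contains a monomial (\<open>exp_deriv_stable_subspace_contains_monomial\<close>).  The polynomials vanishing at
  \<open>\<Psi>\<close> form a nonzero such subspace if \<open>\<Psi>\<close> is algebraic (but no monomial
  vanishes at \<open>\<Psi>\<close>), and the possible denominators of a constant of
  \<open>F(\<Psi>)\<close> form another; a monomial in the latter exhibits the constant as an element of \<open>F\<close>.
\<close>

section \<open>Derivations and polynomials over differential subfields\<close>

context
  fixes D :: "'e::field \<Rightarrow> 'e"
  assumes D: "derivation D"
begin

lemma derivation_add: "D (x + y) = D x + D y"
  and derivation_mult: "D (x * y) = D x * y + x * D y"
  using D by (auto simp: derivation_def)

lemma derivation_0: "D 0 = 0"
  using derivation_add[of 0 0] by (simp only: add_0_left add_cancel_right_right)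

lemma derivation_1: "D 1 = 0"
  using derivation_mult[of 1 1] by (simp only: mult_1_left mult_1_right add_cancel_right_right)

lemma derivation_inverse:
  assumes "x \<noteq> 0"
  shows "D (inverse x) = - D x / x\<^sup>2"
proof -
  have "D x * inverse x + x * D (inverse x) = 0"
    using derivation_mult[of x "inverse x"] assms by (simp add: derivation_1)
  then show ?thesis
    using assms by (simp add: field_simps power2_eq_square add_eq_0_iff)
qed

lemma derivation_divide:
  assumes "y \<noteq> 0"
  shows "D (x / y) = (D x * y - x * D y) / y\<^sup>2"
  using assms derivation_mult[of x "inverse y"] derivation_inverse[OF assms]
  by (simp add: field_simps power2_eq_square)

lemma derivation_poly:
  "D (poly p x) = poly (map_poly D p) x + poly (pderiv p) x * D x"
  by (induction p)
    (simp_all add: derivation_0 derivation_add derivation_mult map_poly_pCons pderiv_pCons algebra_simps)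

end

context
  fixes D :: "'e::field \<Rightarrow> 'e" and M :: "'e set"
  assumes M: "differential_subfield D M"
begin

lemma differential_subfield_closed:
  "0 \<in> M" "1 \<in> M"
  "x \<in> M \<Longrightarrow> y \<in> M \<Longrightarrow> x + y \<in> M"
  "x \<in> M \<Longrightarrow> y \<in> M \<Longrightarrow> x - y \<in> M"
  "x \<in> M \<Longrightarrow> y \<in> M \<Longrightarrow> x * y \<in> M"
  "x \<in> M \<Longrightarrow> inverse x \<in> M"
  "x \<in> M \<Longrightarrow> D x \<in> M"
  using M by (auto simp: differential_subfield_def)

lemma differential_subfield_minus: "x \<in> M \<Longrightarrow> - x \<in> M"
  using differential_subfield_closed(4)[of 0 x] differential_subfield_closed(1) by simp

lemma differential_subfield_of_nat: "of_nat n \<in> M"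
  by (induction n) (auto intro: differential_subfield_closed)

lemma differential_subfield_sum: "(\<And>i. i \<in> I \<Longrightarrow> f i \<in> M) \<Longrightarrow> sum f I \<in> M"
  by (induction I rule: infinite_finite_induct) (auto intro: differential_subfield_closed)

lemma polys_over_0: "0 \<in> polys_over M"
  by (simp add: polys_over_def differential_subfield_closed)

lemma polys_over_pCons: "c \<in> M \<Longrightarrow> p \<in> polys_over M \<Longrightarrow> pCons c p \<in> polys_over M"
  by (auto simp: polys_over_def coeff_pCons split: nat.split)

lemma polys_over_add: "p \<in> polys_over M \<Longrightarrow> q \<in> polys_over M \<Longrightarrow> p + q \<in> polys_over M"
  and polys_over_diff: "p \<in> polys_over M \<Longrightarrow> q \<in> polys_over M \<Longrightarrow> p - q \<in> polys_over M"
  and polys_over_smult: "c \<in> M \<Longrightarrow> p \<in> polys_over M \<Longrightarrow> smult c p \<in> polys_over M"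
  by (auto simp: polys_over_def intro: differential_subfield_closed)

lemma polys_over_mult: "p \<in> polys_over M \<Longrightarrow> q \<in> polys_over M \<Longrightarrow> p * q \<in> polys_over M"
  by (auto simp: polys_over_def coeff_mult
      intro!: differential_subfield_sum differential_subfield_closed)

lemma polys_over_map_derivation:
  "derivation D \<Longrightarrow> p \<in> polys_over M \<Longrightarrow> map_poly D p \<in> polys_over M"
  by (auto simp: polys_over_def coeff_map_poly derivation_0 intro: differential_subfield_closed)

lemma polys_over_pderiv: "p \<in> polys_over M \<Longrightarrow> pderiv p \<in> polys_over M"
  by (auto simp: polys_over_def coeff_pderiv
      intro!: differential_subfield_closed differential_subfield_of_nat simp del: of_nat_Suc)

end

lemma differential_subfield_hull: "differential_subfield d (differential_subfield d hull S)"
  by (rule hull_in) (auto simp: differential_subfield_def)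


section \<open>Adjoining an exponential\<close>

text \<open>
  If \<open>D \<Psi> = \<phi> * \<Psi>\<close>, this is the derivation of \<open>F[Y]\<close> that evaluation at \<open>\<Psi>\<close> turns into \<open>D\<close>:
  it extends \<open>D\<close> by \<open>Y \<mapsto> \<phi> Y\<close>, and so acts diagonally on the monomials.
\<close>

definition exp_deriv :: "('e::field \<Rightarrow> 'e) \<Rightarrow> 'e \<Rightarrow> 'e poly \<Rightarrow> 'e poly" where
  "exp_deriv D \<phi> p = map_poly D p + smult \<phi> (pCons 0 (pderiv p))"

lemma coeff_exp_deriv:
  assumes "derivation D"
  shows "coeff (exp_deriv D \<phi> p) i = D (coeff p i) + of_nat i * \<phi> * coeff p i"
  by (cases i)
    (simp_all add: exp_deriv_def coeff_map_poly derivation_0[OF assms] coeff_pderiv)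

lemma derivation_poly_exp:
  assumes "derivation D" and "D \<Psi> = \<phi> * \<Psi>"
  shows "D (poly p \<Psi>) = poly (exp_deriv D \<phi> p) \<Psi>"
  by (simp add: derivation_poly[OF assms(1)] assms(2) exp_deriv_def algebra_simps)

lemma polys_over_exp_deriv:
  assumes "derivation D" "differential_subfield D F" "\<phi> \<in> F" "p \<in> polys_over F"
  shows "exp_deriv D \<phi> p \<in> polys_over F"
  unfolding exp_deriv_def
  using assms
  by (intro polys_over_add[OF assms(2)] polys_over_map_derivation[OF assms(2)]
      polys_over_smult[OF assms(2)] polys_over_pCons[OF assms(2)] polys_over_pderiv[OF assms(2)]
      differential_subfield_closed[OF assms(2)])

text \<open>
  A nonzero solution of \<open>D a = m * \<phi> * a\<close> is, up to a constant factor, the \<open>m\<close>-th power of an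
  exponential of \<open>\<phi>\<close>; the hypothesis \<open>no_exp\<close> keeps these out of \<open>F\<close>.
\<close>

context
  fixes D :: "'e::field \<Rightarrow> 'e" and F :: "'e set" and \<phi> :: 'e
  assumes D: "derivation D" and F: "differential_subfield D F" and phi: "\<phi> \<in> F"
    and no_exp: "\<And>a m. a \<in> F \<Longrightarrow> m > 0 \<Longrightarrow> D a = of_nat m * \<phi> * a \<Longrightarrow> a = 0"
begin

text \<open>
  The coefficient \<open>a\<close> of \<open>Y\<^sup>i\<close> in an eigenvector satisfies \<open>D a = (n - i) * \<phi> * a\<close>.  For \<open>i > n\<close> the
  factor is negative, and \<open>no_exp\<close> applies to the inverse of \<open>a\<close>.
\<close>

lemma exp_deriv_eigenvector_is_monomial:
  assumes p: "p \<in> polys_over F" and eigen: "exp_deriv D \<phi> p = smult (of_nat n * \<phi>) p"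
  shows "p = monom (coeff p n) n"
proof (rule poly_eqI)
  fix i
  define a where "a = coeff p i"
  have aF: "a \<in> F"
    using p by (simp add: polys_over_def a_def)
  have eq: "D a + of_nat i * \<phi> * a = of_nat n * \<phi> * a"
    using arg_cong[OF eigen, of "\<lambda>q. coeff q i"] by (simp add: coeff_exp_deriv[OF D] a_def)
  consider "i = n" | "i < n" | "n < i"
    by linarith
  then show "coeff p i = coeff (monom (coeff p n) n) i"
  proof cases
    case 2
    then have "D a = of_nat (n - i) * \<phi> * a"
      using eq by (simp add: of_nat_diff algebra_simps)
    then show ?thesis
      using no_exp[OF aF, of "n - i"] 2 by (simp add: a_def)
  next
    case 3
    have "a = 0"
    proof (rule ccontr)
      assume "a \<noteq> 0"
      have "D a = - (of_nat (i - n) * \<phi> * a)"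
        using eq 3 by (simp add: of_nat_diff algebra_simps)
      then have "D (inverse a) = (of_nat (i - n) * \<phi> * a) / a\<^sup>2"
        using \<open>a \<noteq> 0\<close> by (simp add: derivation_inverse[OF D])
      also have "\<dots> = of_nat (i - n) * \<phi> * inverse a"
        using \<open>a \<noteq> 0\<close> by (simp add: power2_eq_square divide_inverse)
      finally have "inverse a = 0"
        using no_exp[of "inverse a" "i - n"] aF 3 differential_subfield_closed[OF F] by simp
      then show False
        using \<open>a \<noteq> 0\<close> by simp
    qed
    then show ?thesis
      using 3 by (simp add: a_def)
  qed simp
qed

text \<open>
  In a nonzero \<open>F\<close>-subspace stable under the derivation, take \<open>p\<close> monic of least degree \<open>n\<close>.  Then
  \<open>exp_deriv D \<phi> p - n \<phi> p\<close> has smaller degree, since the leading term cancels, so it vanishes and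
  \<open>p\<close> is an eigenvector.
\<close>

lemma exp_deriv_stable_subspace_contains_monomial:
  assumes V: "V \<subseteq> polys_over F"
    and diff: "\<And>p q. p \<in> V \<Longrightarrow> q \<in> V \<Longrightarrow> p - q \<in> V"
    and smult: "\<And>c p. c \<in> F \<Longrightarrow> p \<in> V \<Longrightarrow> smult c p \<in> V"
    and stable: "\<And>p. p \<in> V \<Longrightarrow> exp_deriv D \<phi> p \<in> V"
    and "q \<in> V" "q \<noteq> 0"
  obtains n where "monom 1 n \<in> V"
proof -
  obtain p0 where p0: "p0 \<in> V" "p0 \<noteq> 0"
    and least: "\<And>p. p \<in> V \<Longrightarrow> p \<noteq> 0 \<Longrightarrow> degree p0 \<le> degree p"
    using ex_has_least_nat[of "\<lambda>p. p \<in> V \<and> p \<noteq> 0" q degree] assms(5,6) by blast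
  define n where "n = degree p0"
  define p where "p = smult (inverse (lead_coeff p0)) p0"
  have "lead_coeff p0 \<in> F"
    using p0 V by (auto simp: polys_over_def)
  then have pV: "p \<in> V"
    unfolding p_def by (intro smult p0 differential_subfield_closed[OF F])
  have pn: "coeff p n = 1"
    using p0 by (simp add: p_def n_def)
  have degp: "degree p = n"
    using p0 by (simp add: p_def n_def)
  define q where "q = exp_deriv D \<phi> p - smult (of_nat n * \<phi>) p"
  have qV: "q \<in> V"
    unfolding q_def
    by (intro diff stable smult pV differential_subfield_closed[OF F] phi
        differential_subfield_of_nat[OF F])
  have "coeff q i = 0" if "i \<ge> n" for i
  proof (cases "i = n")
    case True
    then show ?thesis
      by (simp add: q_def coeff_exp_deriv[OF D] pn derivation_1[OF D])
  next
    case False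
    then have "coeff p i = 0"
      using that degp by (intro coeff_eq_0) simp
    then show ?thesis
      by (simp add: q_def coeff_exp_deriv[OF D] derivation_0[OF D])
  qed
  then have "q = 0 \<or> degree q < n"
    by (metis leI leading_coeff_0_iff)
  then have "q = 0"
    using least[OF qV] unfolding n_def by (metis leD)
  then have "p = monom (coeff p n) n"
    using V pV by (intro exp_deriv_eigenvector_is_monomial) (auto simp: q_def)
  then show ?thesis
    using that[of n] pV pn by simp
qed

context
  fixes \<Psi> :: 'e
  assumes Psi: "\<Psi> \<noteq> 0" "D \<Psi> = \<phi> * \<Psi>"
begin

text \<open>
  The polynomials over \<open>F\<close> that vanish at \<open>\<Psi>\<close> form a stable subspace, which contains no monomial
  because \<open>\<Psi>\<close> is not zero.
\<close>

lemma exponential_transcendental: "transcendental_over F \<Psi>"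
  unfolding transcendental_over_def
proof (intro ballI impI, rule ccontr)
  fix p assume p: "p \<in> polys_over F" "poly p \<Psi> = 0" "p \<noteq> 0"
  define V where "V = {q \<in> polys_over F. poly q \<Psi> = 0}"
  have "exp_deriv D \<phi> q \<in> V" if "q \<in> V" for q
    using that polys_over_exp_deriv[OF D F phi, of q] derivation_poly_exp[OF D Psi(2), of q]
    by (simp add: V_def derivation_0[OF D])
  then obtain n where "monom 1 n \<in> V"
    using exp_deriv_stable_subspace_contains_monomial[of V p] p
    by (auto simp: V_def polys_over_diff[OF F] polys_over_smult[OF F])
  then show False
    using Psi(1) by (simp add: V_def poly_monom)
qed

lemma hull_exponential_subset:
  "differential_subfield D hull (insert \<Psi> F)
     \<subseteq> {poly p \<Psi> / poly q \<Psi> | p q. p \<in> polys_over F \<and> q \<in> polys_over F \<and> poly q \<Psi> \<noteq> 0}"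
    (is "_ \<subseteq> ?Q")
proof (rule hull_minimal)
  note over = polys_over_add[OF F] polys_over_diff[OF F] polys_over_mult[OF F]
    polys_over_pCons[OF F] polys_over_0[OF F] polys_over_exp_deriv[OF D F phi]
    differential_subfield_closed[OF F]
  have Q_I: "poly p \<Psi> / poly q \<Psi> \<in> ?Q"
    if "p \<in> polys_over F" "q \<in> polys_over F" "poly q \<Psi> \<noteq> 0" for p q
    using that by blast
  have const: "x \<in> ?Q" if "x \<in> F" for x
    using Q_I[of "[:x:]" "[:1:]"] that over by simp
  have "\<Psi> \<in> ?Q"
    using Q_I[of "[:0, 1:]" "[:1:]"] over by simp
  with const show "insert \<Psi> F \<subseteq> ?Q"
    by blast
  have ring: "x + y \<in> ?Q \<and> x - y \<in> ?Q \<and> x * y \<in> ?Q" if xy: "x \<in> ?Q" "y \<in> ?Q" for x y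
  proof -
    obtain p q where x: "x = poly p \<Psi> / poly q \<Psi>"
      and pq: "p \<in> polys_over F" "q \<in> polys_over F" "poly q \<Psi> \<noteq> 0"
      using xy(1) by blast
    obtain p' q' where y: "y = poly p' \<Psi> / poly q' \<Psi>"
      and pq': "p' \<in> polys_over F" "q' \<in> polys_over F" "poly q' \<Psi> \<noteq> 0"
      using xy(2) by blast
    have "poly (p * q' + p' * q) \<Psi> / poly (q * q') \<Psi> = x + y"
      "poly (p * q' - p' * q) \<Psi> / poly (q * q') \<Psi> = x - y"
      "poly (p * p') \<Psi> / poly (q * q') \<Psi> = x * y"
      using pq pq' by (simp_all add: x y field_simps)
    then show ?thesis
      using Q_I[of "p * q' + p' * q" "q * q'"] Q_I[of "p * q' - p' * q" "q * q'"]
        Q_I[of "p * p'" "q * q'"] pq pq' over by simp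
  qed
  have inv: "inverse x \<in> ?Q" if "x \<in> ?Q" for x
  proof (cases "x = 0")
    case True
    then show ?thesis
      using const[of 0] over by simp
  next
    case False
    from that obtain p q where x: "x = poly p \<Psi> / poly q \<Psi>"
      and pq: "p \<in> polys_over F" "q \<in> polys_over F" "poly q \<Psi> \<noteq> 0"
      by blast
    then show ?thesis
      using Q_I[of q p] False by simp
  qed
  have deriv: "D x \<in> ?Q" if "x \<in> ?Q" for x
  proof -
    from that obtain p q where x: "x = poly p \<Psi> / poly q \<Psi>"
      and pq: "p \<in> polys_over F" "q \<in> polys_over F" "poly q \<Psi> \<noteq> 0"
      by blast
    have "D x = poly (exp_deriv D \<phi> p * q - p * exp_deriv D \<phi> q) \<Psi> / poly (q * q) \<Psi>"
      using pq(3) by (simp add: x derivation_divide[OF D] derivation_poly_exp[OF D Psi(2)]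
          power2_eq_square)
    then show ?thesis
      using Q_I[of "exp_deriv D \<phi> p * q - p * exp_deriv D \<phi> q" "q * q"] pq over by simp
  qed
  have "0 \<in> ?Q" "1 \<in> ?Q"
    by (intro const over)+
  then show "differential_subfield D ?Q"
    unfolding differential_subfield_def
    by (intro conjI ballI ring[THEN conjunct1] ring[THEN conjunct2, THEN conjunct1]
        ring[THEN conjunct2, THEN conjunct2] inv deriv)
qed

text \<open>
  The polynomials \<open>q\<close> over \<open>F\<close> with \<open>c * q(\<Psi>) \<in> F[\<Psi>]\<close>, for a constant \<open>c\<close>, form a stable subspace.
  So \<open>c * \<Psi>\<^sup>n = p(\<Psi>)\<close> for some \<open>n\<close> and \<open>p\<close>.  The left side is an eigenvector of the derivation, hence
  so is \<open>p\<close>, as \<open>\<Psi>\<close> is transcendental; thus \<open>p\<close> is a multiple of the monomial of degree \<open>n\<close> and \<open>c\<close> is its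
  coefficient.
\<close>

lemma exponential_no_new_constants:
  "constants D \<inter> (differential_subfield D hull (insert \<Psi> F)) = constants D \<inter> F"
proof (intro equalityI subsetI)
  fix c assume "c \<in> constants D \<inter> F"
  then show "c \<in> constants D \<inter> (differential_subfield D hull (insert \<Psi> F))"
    by (auto intro: hull_inc)
next
  fix c assume c: "c \<in> constants D \<inter> (differential_subfield D hull (insert \<Psi> F))"
  then have Dc: "D c = 0"
    by (simp add: constants_def)
  obtain p0 q0 where c_eq: "c = poly p0 \<Psi> / poly q0 \<Psi>"
    and p0q0: "p0 \<in> polys_over F" "q0 \<in> polys_over F" "poly q0 \<Psi> \<noteq> 0"
    using c hull_exponential_subset by blast
  define V where "V = {q \<in> polys_over F. \<exists>p \<in> polys_over F. c * poly q \<Psi> = poly p \<Psi>}"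
  have D_c: "D (c * x) = c * D x" for x
    by (simp add: derivation_mult[OF D] Dc)
  have "q0 \<in> V"
    unfolding V_def using p0q0 by (auto simp: c_eq intro!: bexI[of _ p0])
  moreover have "p - q \<in> V" if pq: "p \<in> V" "q \<in> V" for p q
  proof -
    obtain p' q' where "p' \<in> polys_over F" "c * poly p \<Psi> = poly p' \<Psi>"
      "q' \<in> polys_over F" "c * poly q \<Psi> = poly q' \<Psi>"
      using pq by (auto simp: V_def)
    then show ?thesis
      using pq by (auto simp: V_def polys_over_diff[OF F] right_diff_distrib intro!: bexI[of _ "p' - q'"])
  qed
  moreover have "smult a q \<in> V" if aq: "a \<in> F" "q \<in> V" for a q
  proof -
    obtain q' where "q' \<in> polys_over F" "c * poly q \<Psi> = poly q' \<Psi>"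
      using aq by (auto simp: V_def)
    then show ?thesis
      using aq by (auto simp: V_def polys_over_smult[OF F] mult.left_commute[of c]
          intro!: bexI[of _ "smult a q'"])
  qed
  moreover have "exp_deriv D \<phi> q \<in> V" if q: "q \<in> V" for q
  proof -
    obtain p where p: "p \<in> polys_over F" "c * poly q \<Psi> = poly p \<Psi>"
      using q by (auto simp: V_def)
    then have "c * poly (exp_deriv D \<phi> q) \<Psi> = poly (exp_deriv D \<phi> p) \<Psi>"
      using D_c[of "poly q \<Psi>"] by (simp only: derivation_poly_exp[OF D Psi(2)])
    then show ?thesis
      using q p polys_over_exp_deriv[OF D F phi] by (auto simp: V_def)
  qed
  moreover have "V \<subseteq> polys_over F" "q0 \<noteq> 0"
    using p0q0 by (auto simp: V_def)
  ultimately obtain n where "monom 1 n \<in> V"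
    using exp_deriv_stable_subspace_contains_monomial[of V q0] by blast
  then obtain p where p: "p \<in> polys_over F" and cp: "c * \<Psi> ^ n = poly p \<Psi>"
    by (auto simp: V_def poly_monom)
  have "exp_deriv D \<phi> (monom 1 n) = smult (of_nat n * \<phi>) (monom 1 n)"
    by (rule poly_eqI) (simp add: coeff_exp_deriv[OF D] derivation_0[OF D] derivation_1[OF D])
  then have "D (\<Psi> ^ n) = of_nat n * \<phi> * \<Psi> ^ n"
    using derivation_poly_exp[OF D Psi(2), of "monom 1 n"] by (simp add: poly_monom)
  then have "poly (exp_deriv D \<phi> p - smult (of_nat n * \<phi>) p) \<Psi>
      = c * (of_nat n * \<phi> * \<Psi> ^ n) - of_nat n * \<phi> * (c * \<Psi> ^ n)"
    by (simp add: cp[symmetric] derivation_poly_exp[OF D Psi(2), symmetric] D_c)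
  also have "\<dots> = 0"
    by simp
  finally have "poly (exp_deriv D \<phi> p - smult (of_nat n * \<phi>) p) \<Psi> = 0" .
  moreover have "exp_deriv D \<phi> p - smult (of_nat n * \<phi>) p \<in> polys_over F"
    by (intro polys_over_diff[OF F] polys_over_smult[OF F] polys_over_exp_deriv[OF D F phi]
        differential_subfield_closed[OF F] differential_subfield_of_nat[OF F] p phi)
  ultimately have "exp_deriv D \<phi> p - smult (of_nat n * \<phi>) p = 0"
    using exponential_transcendental unfolding transcendental_over_def by blast
  then have "p = monom (coeff p n) n"
    using p by (intro exp_deriv_eigenvector_is_monomial) auto
  then have "c * \<Psi> ^ n = coeff p n * \<Psi> ^ n"
    using cp by (metis poly_monom)
  then have "c = coeff p n"
    using Psi(1) by simp
  then show "c \<in> constants D \<inter> F"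
    using c p by (auto simp: polys_over_def)
qed

end

end


section \<open>The weight at infinity on the coordinate ring of the curve\<close>

text \<open>
  By \<open>indep\<close>, the element \<open>\<lambda>\<close> is transcendental over \<open>k\<close> and \<open>1, \<mu>\<close> are linearly independent over \<open>k[\<lambda>]\<close>,
  so that \<open>k[\<lambda>, \<mu>]\<close> is the coordinate ring of the curve and \<open>1, \<mu>\<close> is its basis over \<open>k[\<lambda>]\<close>.
\<close>

locale odd_curve =
  fixes D :: "'e::field_char_0 \<Rightarrow> 'e" and k :: "'e set" and r :: "'e poly" and lam mu :: 'e
  assumes D: "derivation D" and k: "differential_subfield D k"
    and r: "r \<in> polys_over k" "odd (degree r)"
    and const_lam_mu: "D lam = 0" "D mu = 0"
    and curve: "mu\<^sup>2 + poly r lam = 0"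
    and indep: "\<And>p q. p \<in> polys_over k \<Longrightarrow> q \<in> polys_over k \<Longrightarrow> poly p lam + poly q lam * mu = 0
      \<Longrightarrow> p = 0 \<and> q = 0"
begin

lemmas k_closed = differential_subfield_closed[OF k] differential_subfield_of_nat[OF k]

lemmas polys_over_k = polys_over_0[OF k] polys_over_pCons[OF k] polys_over_add[OF k]
  polys_over_diff[OF k] polys_over_mult[OF k] polys_over_map_derivation[OF k D]

definition coord :: "'e poly \<Rightarrow> 'e poly \<Rightarrow> 'e" where
  "coord p q = poly p lam + poly q lam * mu"

definition B :: "'e set" where
  "B = {coord p q | p q. p \<in> polys_over k \<and> q \<in> polys_over k}"

lemma B_I: "p \<in> polys_over k \<Longrightarrow> q \<in> polys_over k \<Longrightarrow> coord p q \<in> B"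
  by (auto simp: B_def)

lemma B_E:
  assumes "x \<in> B"
  obtains p q where "p \<in> polys_over k" "q \<in> polys_over k" "x = coord p q"
  using assms by (auto simp: B_def)

lemma coord_add: "coord p q + coord p' q' = coord (p + p') (q + q')"
  and coord_diff: "coord p q - coord p' q' = coord (p - p') (q - q')"
  by (simp_all add: coord_def algebra_simps)

lemma coord_mult: "coord p q * coord p' q' = coord (p * p' - r * (q * q')) (p * q' + q * p')"
proof -
  have mu2: "mu * (mu * z) = - (poly r lam * z)" for z
    using curve by (simp add: power2_eq_square add_eq_0_iff2 flip: mult.assoc)
  show ?thesis
    by (simp add: coord_def algebra_simps mu2)
qed

lemma derivation_coord: "D (coord p q) = coord (map_poly D p) (map_poly D q)"
  by (simp add: coord_def derivation_add[OF D] derivation_mult[OF D] derivation_poly[OF D] const_lam_mu)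

lemma coord_eq_iff:
  assumes "p \<in> polys_over k" "q \<in> polys_over k" "p' \<in> polys_over k" "q' \<in> polys_over k"
  shows "coord p q = coord p' q' \<longleftrightarrow> p = p' \<and> q = q'"
proof
  assume "coord p q = coord p' q'"
  then have "coord (p - p') (q - q') = 0"
    by (simp flip: coord_diff)
  then show "p = p' \<and> q = q'"
    using indep[of "p - p'" "q - q'"] assms by (simp add: coord_def polys_over_k)
qed simp

lemma B_closed:
  assumes "x \<in> B" "y \<in> B"
  shows "x + y \<in> B" "x - y \<in> B" "x * y \<in> B" "D x \<in> B"
  using assms r(1)
  by (auto elim!: B_E simp: coord_add coord_diff coord_mult derivation_coord intro!: B_I polys_over_k)

lemma coord_const: "coord [:c:] 0 = c"
  by (simp add: coord_def)

lemma k_subset_B: "c \<in> k \<Longrightarrow> c \<in> B"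
  using B_I[of "[:c:]" 0] by (simp add: coord_const polys_over_k)

text \<open>
  The norm of \<open>p + q \<mu>\<close> down to \<open>k[\<lambda>]\<close>.  Its degree is the order of the pole at the point at infinity.
\<close>

definition nrm :: "'e poly \<Rightarrow> 'e poly \<Rightarrow> 'e poly" where
  "nrm p q = p\<^sup>2 + r * q\<^sup>2"

text \<open>
  The degrees of \<open>p\<^sup>2\<close> and \<open>r q\<^sup>2\<close> have different parity, so the leading terms cannot cancel.
\<close>

lemma degree_nrm_le_iff:
  "degree (nrm p q) \<le> n \<longleftrightarrow> 2 * degree p \<le> n \<and> (q = 0 \<or> degree r + 2 * degree q \<le> n)"
proof -
  have r0: "r \<noteq> 0"
    using r(2) by auto
  have deg_p: "degree (p\<^sup>2) = 2 * degree p"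
    by (cases "p = 0") (simp_all add: degree_power_eq)
  show ?thesis
  proof (cases "q = 0")
    case True
    then show ?thesis
      by (simp add: nrm_def deg_p)
  next
    case False
    then have deg_q: "degree (r * q\<^sup>2) = degree r + 2 * degree q"
      using r0 by (simp add: degree_mult_eq degree_power_eq)
    then have "degree (p\<^sup>2) \<noteq> degree (r * q\<^sup>2)"
      using r(2) deg_p by presburger
    then consider "degree (p\<^sup>2) < degree (r * q\<^sup>2)" | "degree (r * q\<^sup>2) < degree (p\<^sup>2)"
      by linarith
    then show ?thesis
      using False deg_p deg_q
      by cases (auto simp: nrm_def degree_add_eq_left degree_add_eq_right)
  qed
qed

lemma nrm_eq_0_iff: "nrm p q = 0 \<longleftrightarrow> p = 0 \<and> q = 0"
proof
  assume nrm: "nrm p q = 0"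
  then have "degree (nrm p q) \<le> 0"
    by simp
  then have "q = 0"
    using r(2) unfolding degree_nrm_le_iff by auto
  then show "p = 0 \<and> q = 0"
    using nrm by (simp add: nrm_def)
qed (simp add: nrm_def)

lemma nrm_mult: "nrm (p * p' - r * (q * q')) (p * q' + q * p') = nrm p q * nrm p' q'"
  by (simp add: nrm_def power2_eq_square algebra_simps)

text \<open>
  Coordinates with respect to \<open>1, \<mu>\<close> are unique, so the description determines the weight.  The weight of
  \<open>0\<close> is \<open>0\<close> and not minus infinity, which is why additivity needs nonzero factors.
\<close>

definition wt :: "'e \<Rightarrow> nat" where
  "wt x = (THE n. \<exists>p\<in>polys_over k. \<exists>q\<in>polys_over k. x = coord p q \<and> n = degree (nrm p q))"

lemma wt_coord:
  assumes "p \<in> polys_over k" "q \<in> polys_over k"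
  shows "wt (coord p q) = degree (nrm p q)"
  unfolding wt_def
proof (rule the_equality)
  show "\<exists>p'\<in>polys_over k. \<exists>q'\<in>polys_over k.
      coord p q = coord p' q' \<and> degree (nrm p q) = degree (nrm p' q')"
    using assms by blast
qed (use assms coord_eq_iff in auto)

lemma wt_const: "c \<in> k \<Longrightarrow> wt c = 0"
  using wt_coord[of "[:c:]" 0] by (simp add: coord_const polys_over_k nrm_def power2_eq_square)

lemma wt_diff_lam: "v \<in> k \<Longrightarrow> wt (v - lam) = 2" and diff_lam_in_B: "v \<in> k \<Longrightarrow> v - lam \<in> B"
proof -
  assume v: "v \<in> k"
  have "[:v, -1:] \<in> polys_over k"
    using v by (intro polys_over_k differential_subfield_minus[OF k] k_closed)
  moreover have "coord [:v, -1:] 0 = v - lam"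
    by (simp add: coord_def)
  ultimately show "wt (v - lam) = 2" "v - lam \<in> B"
    using wt_coord[of "[:v, -1:]" 0] B_I[of "[:v, -1:]" 0]
    by (simp_all add: polys_over_k nrm_def power2_eq_square)
qed

lemma wt_mult:
  assumes "x \<in> B" "y \<in> B" "x \<noteq> 0" "y \<noteq> 0"
  shows "wt (x * y) = wt x + wt y"
proof -
  obtain p q where x: "p \<in> polys_over k" "q \<in> polys_over k" "x = coord p q"
    using assms(1) by (rule B_E)
  obtain p' q' where y: "p' \<in> polys_over k" "q' \<in> polys_over k" "y = coord p' q'"
    using assms(2) by (rule B_E)
  have "nrm p q \<noteq> 0" "nrm p' q' \<noteq> 0"
    using assms(3,4) x y by (auto simp: nrm_eq_0_iff coord_def)
  then show ?thesis
    using x y r(1)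
    by (simp add: coord_mult wt_coord polys_over_k nrm_mult degree_mult_eq)
qed

lemma wt_mult_le:
  assumes "x \<in> B" "y \<in> B"
  shows "wt (x * y) \<le> wt x + wt y"
  using assms wt_mult[of x y] wt_const[of 0] k_closed by (cases "x = 0 \<or> y = 0") auto

lemma wt_le_iff:
  assumes "p \<in> polys_over k" "q \<in> polys_over k"
  shows "wt (coord p q) \<le> n \<longleftrightarrow> 2 * degree p \<le> n \<and> (q = 0 \<or> degree r + 2 * degree q \<le> n)"
  by (simp add: wt_coord[OF assms] degree_nrm_le_iff)

lemma wt_add_le:
  assumes "x \<in> B" "y \<in> B" "wt x \<le> n" "wt y \<le> n"
  shows "wt (x + y) \<le> n"
proof -
  obtain p q where x: "p \<in> polys_over k" "q \<in> polys_over k" "x = coord p q"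
    using assms(1) by (rule B_E)
  obtain p' q' where y: "p' \<in> polys_over k" "q' \<in> polys_over k" "y = coord p' q'"
    using assms(2) by (rule B_E)
  have "degree (p + p') \<le> max (degree p) (degree p')" "degree (q + q') \<le> max (degree q) (degree q')"
    by (rule degree_add_le_max)+
  then show ?thesis
    using assms(3,4) x y by (auto simp: coord_add wt_le_iff polys_over_k)
qed

lemma wt_diff_le:
  assumes "x \<in> B" "y \<in> B" "wt x \<le> n" "wt y \<le> n"
  shows "wt (x - y) \<le> n"
proof -
  have m1: "-1 \<in> k"
    by (intro differential_subfield_minus[OF k] k_closed)
  then have "wt (-1 * y) \<le> n"
    using wt_mult_le[of "-1" y] assms wt_const[of "-1"] k_subset_B by simp
  then show ?thesis
    using wt_add_le[of x "-1 * y" n] assms B_closed(3)[of "-1" y] k_subset_B m1 by simp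
qed

text \<open>The derivation acts on coefficients only, so it does not raise degrees in \<open>\<lambda>\<close>.\<close>

lemma wt_derivation_le:
  assumes "x \<in> B"
  shows "wt (D x) \<le> wt x"
proof -
  obtain p q where x: "p \<in> polys_over k" "q \<in> polys_over k" "x = coord p q"
    using assms by (rule B_E)
  have "degree (map_poly D p) \<le> degree p" "degree (map_poly D q) \<le> degree q"
    by (rule map_poly_degree_leq)+
  moreover have "2 * degree p \<le> wt x \<and> (q = 0 \<or> degree r + 2 * degree q \<le> wt x)"
    using wt_le_iff[OF x(1,2)] x(3) by blast
  ultimately show ?thesis
    using x by (auto simp: derivation_coord wt_le_iff polys_over_k)
qed

lemma wt_wronskian_le:
  assumes "x \<in> B" "y \<in> B"
  shows "wt (D x * y - x * D y) \<le> wt x + wt y" "D x * y - x * D y \<in> B"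
proof -
  have mem: "D x \<in> B" "D y \<in> B" "D x * y \<in> B" "x * D y \<in> B"
    using assms by (auto intro: B_closed)
  have "wt (D x * y) \<le> wt x + wt y" "wt (x * D y) \<le> wt x + wt y"
    using wt_mult_le[of "D x" y] wt_mult_le[of x "D y"] wt_derivation_le assms mem
    by (meson add_mono le_refl order_trans)+
  then show "wt (D x * y - x * D y) \<le> wt x + wt y"
    using mem wt_diff_le by blast
  show "D x * y - x * D y \<in> B"
    using mem(3,4) by (rule B_closed)
qed


section \<open>Exponentials of Riccati solutions over the curve\<close>

text \<open>
  For \<open>a = z / t\<close> the logarithmic derivative is \<open>(D z * t - z * D t) / (z * t)\<close>, and the numerator weighs
  no more than the denominator.
\<close>

lemma log_derivative_no_pole:
  assumes B: "x \<in> B" "y \<in> B" "z \<in> B" "t \<in> B" and nz: "y \<noteq> 0" "z \<noteq> 0" "t \<noteq> 0"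
    and m: "m > 0"
    and eq: "D (z / t) = of_nat m * (x / y) * (z / t)"
  shows "wt x \<le> wt y"
proof (cases "x = 0")
  case True
  then show ?thesis
    using wt_const[of 0] k_closed by simp
next
  case False
  define c :: 'e where "c = of_nat m"
  have c: "c \<in> B" "c \<noteq> 0" "wt c = 0"
    using m k_closed by (auto simp: c_def intro: k_subset_B wt_const)
  have "y * (D z * t - z * D t) = y * t\<^sup>2 * D (z / t)"
    using nz by (simp add: derivation_divide[OF D])
  also have "\<dots> = c * x * z * t"
    using nz by (simp add: eq c_def power2_eq_square)
  finally have eq': "c * x * z * t = y * (D z * t - z * D t)" ..
  have "wt (c * x * z * t) = wt x + wt z + wt t"
    using B nz c False by (simp add: wt_mult B_closed)
  moreover have "wt (c * x * z * t) \<le> wt y + (wt z + wt t)"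
    unfolding eq'
    using wt_mult_le[OF B(2) wt_wronskian_le(2)[OF B(3,4)]] wt_wronskian_le(1)[OF B(3,4)]
    by linarith
  ultimately show ?thesis
    by linarith
qed

text \<open>
  A solution of the Riccati equation has a pole at infinity: otherwise \<open>D \<phi> + \<phi>\<^sup>2\<close> would have none, but
  \<open>v - \<lambda>\<close> has a double pole there.
\<close>

lemma riccati_solution_pole:
  assumes B: "x \<in> B" "y \<in> B" and nz: "y \<noteq> 0" and v: "v \<in> k"
    and eq: "D (x / y) + (x / y)\<^sup>2 = v - lam"
  shows "wt y < wt x"
proof (rule ccontr)
  assume "\<not> wt y < wt x"
  then have le: "wt x \<le> wt y"
    by simp
  have "(D x * y - x * D y) + x * x = (v - lam) * (y * y)"
    using eq nz unfolding derivation_divide[OF D nz]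
    by (simp add: field_simps power2_eq_square)
  moreover have "wt ((v - lam) * (y * y)) = 2 + (wt y + wt y)"
  proof -
    have "v - lam \<noteq> 0"
      using wt_diff_lam[OF v] wt_const[of 0] k_closed by auto
    then show ?thesis
      using wt_diff_lam[OF v] diff_lam_in_B[OF v] B nz by (simp add: wt_mult B_closed)
  qed
  moreover have "wt ((D x * y - x * D y) + x * x) \<le> wt y + wt y"
  proof (rule wt_add_le[OF wt_wronskian_le(2)[OF B] B_closed(3)[OF B(1) B(1)]])
    show "wt (D x * y - x * D y) \<le> wt y + wt y" "wt (x * x) \<le> wt y + wt y"
      using wt_wronskian_le(1)[OF B] wt_mult_le[OF B(1) B(1)] le by linarith+
  qed
  ultimately show False
    by simp
qed

lemma no_exponential_of_riccati_solution:
  assumes F: "F = {x / y | x y. x \<in> B \<and> y \<in> B \<and> y \<noteq> 0}"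
    and "\<phi> \<in> F" "v \<in> k" "D \<phi> + \<phi>\<^sup>2 = v - lam"
    and "a \<in> F" "m > 0" "D a = of_nat m * \<phi> * a"
  shows "a = 0"
proof (rule ccontr)
  assume "a \<noteq> 0"
  obtain x y where phi: "\<phi> = x / y" "x \<in> B" "y \<in> B" "y \<noteq> 0"
    using assms(2) F by blast
  obtain z t where a: "a = z / t" "z \<in> B" "t \<in> B" "t \<noteq> 0"
    using assms(5) F by blast
  have "wt y < wt x"
    using riccati_solution_pole assms(3,4) phi by blast
  moreover have "wt x \<le> wt y"
    using log_derivative_no_pole[of x y z t m] assms(6,7) phi a \<open>a \<noteq> 0\<close> by auto
  ultimately show False
    by simp
qed

end


section \<open>The function field of the spectral curve\<close>

context
  fixes d :: "'a::field \<Rightarrow> 'a" and D :: "'e::field \<Rightarrow> 'e" and K :: "'a set" and emb :: "'a \<Rightarrow> 'e"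
  assumes K: "differential_subfield d K" and hom: "field_hom_on K emb"
begin

lemma emb_hom:
  "emb 1 = 1" "x \<in> K \<Longrightarrow> y \<in> K \<Longrightarrow> emb (x + y) = emb x + emb y"
  "x \<in> K \<Longrightarrow> y \<in> K \<Longrightarrow> emb (x * y) = emb x * emb y"
  using hom by (auto simp: field_hom_on_def)

lemma emb_0: "emb 0 = 0"
  using emb_hom(2)[OF differential_subfield_closed(1,1)[OF K]]
  by (simp only: add_0_left add_cancel_right_right)

lemma emb_minus: "x \<in> K \<Longrightarrow> emb (- x) = - emb x"
  using emb_hom(2)[of x "- x"] differential_subfield_minus[OF K, of x] emb_0
  by (simp add: add_eq_0_iff)

lemma emb_diff: "x \<in> K \<Longrightarrow> y \<in> K \<Longrightarrow> emb (x - y) = emb x - emb y"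
  using emb_hom(2)[of x "- y"] differential_subfield_minus[OF K, of y] emb_minus[of y] by simp

lemma emb_eq_0_iff: "x \<in> K \<Longrightarrow> emb x = 0 \<longleftrightarrow> x = 0"
  using emb_hom(1) emb_hom(3)[of x "inverse x"] differential_subfield_closed[OF K] emb_0
  by (cases "x = 0") auto

lemma emb_inverse: "x \<in> K \<Longrightarrow> emb (inverse x) = inverse (emb x)"
  using emb_hom(1) emb_hom(3)[of x "inverse x"] differential_subfield_closed[OF K] emb_0
  by (cases "x = 0") (auto simp: inverse_unique)

lemma differential_subfield_image:
  assumes "\<forall>x\<in>K. D (emb x) = emb (d x)"
  shows "differential_subfield D (emb ` K)"
proof -
  note K = differential_subfield_closed[OF K]
  have "0 \<in> emb ` K" "1 \<in> emb ` K"
    using emb_0 emb_hom(1) K by (metis imageI)+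
  moreover have "x + y \<in> emb ` K \<and> x - y \<in> emb ` K \<and> x * y \<in> emb ` K \<and> inverse x \<in> emb ` K \<and> D x \<in> emb ` K"
    if "x \<in> emb ` K" "y \<in> emb ` K" for x y
    using that K assms
    by (auto simp: emb_hom(2,3)[symmetric] emb_diff[symmetric] emb_inverse[symmetric])
  ultimately show ?thesis
    unfolding differential_subfield_def by blast
qed

lemma coeff_map_emb: "coeff (map_poly emb p) i = emb (coeff p i)"
  by (simp add: coeff_map_poly emb_0)

lemma map_emb_in_polys_over: "p \<in> polys_over K \<Longrightarrow> map_poly emb p \<in> polys_over (emb ` K)"
  by (simp add: polys_over_def coeff_map_emb)

text \<open>
  Polynomials over the image of \<open>K\<close> are lifted coefficientwise; the section \<open>g\<close> of \<open>emb\<close> must fix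
  \<open>0\<close> for this to be \<^const>\<open>map_poly\<close>.
\<close>

lemma polys_over_image_E:
  assumes "q \<in> polys_over (emb ` K)"
  obtains p where "p \<in> polys_over K" "q = map_poly emb p"
proof -
  define g where "g y = (if y = 0 then 0 else inv_into K emb y)" for y
  have g: "g y \<in> K \<and> emb (g y) = y" if "y \<in> emb ` K" for y
    using that emb_0 differential_subfield_closed(1)[OF K]
    by (auto simp: g_def inv_into_into f_inv_into_f)
  have "coeff (map_poly g q) i = g (coeff q i)" for i
    by (simp add: coeff_map_poly g_def)
  then have "map_poly g q \<in> polys_over K" "q = map_poly emb (map_poly g q)"
    using g assms by (auto simp: polys_over_def coeff_map_emb intro!: poly_eqI)
  then show ?thesis
    using that by blast
qed

lemma eval2_pCons:
  "eval2 emb lam mu (pCons p g) = poly (map_poly emb p) lam + mu * eval2 emb lam mu g"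
  by (simp add: eval2_def map_poly_pCons)

lemma eval2_0: "eval2 emb lam mu 0 = 0"
  by (simp add: eval2_def)

lemma degree_map_emb:
  assumes "p \<in> polys_over K"
  shows "degree (map_poly emb p) = degree p"
proof (cases "p = 0")
  case False
  then show ?thesis
    using assms emb_eq_0_iff[of "lead_coeff p"]
    by (intro map_poly_degree_eq) (auto simp: polys_over_def)
qed simp

context
  fixes R :: "'a poly" and lam mu :: 'e and F :: "'e set"
  assumes curve: "curve_function_field K (spectral_poly R) emb lam mu F"
    and R: "R \<in> polys_over K"
begin

lemma pair_in_polys_over:
  "p \<in> polys_over K \<Longrightarrow> q \<in> polys_over K \<Longrightarrow> [:p, q:] \<in> polys_over (polys_over K)"
  using polys_over_0[OF K] by (auto simp: polys_over_def[of "polys_over K"] coeff_pCons split: nat.split)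

lemma kernel:
  "g \<in> polys_over (polys_over K) \<Longrightarrow> eval2 emb lam mu g = 0 \<longleftrightarrow>
     (\<exists>h\<in>polys_over (polys_over K). g = spectral_poly R * h)"
  using curve by (simp add: curve_function_field_def)

lemma spectral_curve_equation: "mu\<^sup>2 + poly (map_poly emb R) lam = 0"
proof -
  have one: "1 \<in> polys_over K"
    using polys_over_pCons[OF K, of 1 0] polys_over_0[OF K] differential_subfield_closed[OF K]
    by (simp add: one_pCons)
  have "spectral_poly R \<in> polys_over (polys_over K)"
    using R polys_over_0[OF K] one
    by (auto simp: spectral_poly_def polys_over_def[of "polys_over K"] coeff_pCons split: nat.split)
  moreover have "1 \<in> polys_over (polys_over K)"
    using pair_in_polys_over[OF one polys_over_0[OF K]] by (simp add: one_pCons)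
  ultimately have "eval2 emb lam mu (spectral_poly R) = 0"
    using kernel by force
  then show ?thesis
    by (simp add: spectral_poly_def eval2_pCons eval2_0 emb_hom(1) power2_eq_square add.commute)
qed

text \<open>A multiple of \<open>\<mu>\<^sup>2 + R(\<lambda>)\<close> of degree less than \<open>2\<close> in \<open>\<mu>\<close> is zero.\<close>

lemma spectral_coordinates_unique:
  assumes "p \<in> polys_over (emb ` K)" "q \<in> polys_over (emb ` K)"
    and "poly p lam + poly q lam * mu = 0"
  shows "p = 0 \<and> q = 0"
proof -
  obtain p' where p': "p' \<in> polys_over K" "p = map_poly emb p'"
    using assms(1) by (rule polys_over_image_E)
  obtain q' where q': "q' \<in> polys_over K" "q = map_poly emb q'"
    using assms(2) by (rule polys_over_image_E)
  have "eval2 emb lam mu [:p', q':] = 0"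
    using assms(3) p' q' by (simp add: eval2_pCons eval2_0 mult.commute)
  then obtain h where h: "[:p', q':] = spectral_poly R * h"
    using kernel pair_in_polys_over p' q' by blast
  have "h = 0"
  proof (rule ccontr)
    assume "h \<noteq> 0"
    then have "degree [:p', q':] = 2 + degree h"
      unfolding h by (subst degree_mult_eq) (auto simp: spectral_poly_def)
    moreover have "degree [:p', q':] \<le> 1"
      by simp
    ultimately show False
      by linarith
  qed
  then show ?thesis
    using h p' q' by simp
qed

text \<open>
  Horner's scheme in \<open>\<mu>\<close>, with \<open>\<mu>\<^sup>2\<close> replaced by \<open>- R(\<lambda>)\<close> at each step.
\<close>

lemma eval2_reduce:
  assumes "g \<in> polys_over (polys_over K)"
    and "differential_subfield D (emb ` K)"
  shows "\<exists>p\<in>polys_over (emb ` K). \<exists>q\<in>polys_over (emb ` K).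
           eval2 emb lam mu g = poly p lam + poly q lam * mu"
  using assms(1)
proof (induction g)
  case 0
  then show ?case
    using polys_over_0[OF assms(2)] by (intro bexI[of _ 0]) (auto simp: eval2_0)
next
  case (pCons c g)
  have c: "c \<in> polys_over K" and g: "g \<in> polys_over (polys_over K)"
    using pCons.prems unfolding polys_over_def[of "polys_over K"]
    by (auto dest: spec[of _ "0::nat"] spec[of _ "Suc _"])
  obtain p q where pq: "p \<in> polys_over (emb ` K)" "q \<in> polys_over (emb ` K)"
    "eval2 emb lam mu g = poly p lam + poly q lam * mu"
    using pCons.IH[OF g] by blast
  let ?p = "map_poly emb c - map_poly emb R * q"
  have mu2: "mu * (mu * z) = - (poly (map_poly emb R) lam * z)" for z
    using spectral_curve_equation by (simp add: power2_eq_square add_eq_0_iff2 flip: mult.assoc)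
  have "eval2 emb lam mu (pCons c g) = poly ?p lam + poly p lam * mu"
    by (simp add: eval2_pCons pq(3) algebra_simps mu2)
  moreover have "?p \<in> polys_over (emb ` K)"
    using c R pq by (intro polys_over_diff[OF assms(2)] polys_over_mult[OF assms(2)] map_emb_in_polys_over)
  ultimately show ?case
    using pq by blast
qed

lemma function_field_quotients:
  assumes "differential_subfield D (emb ` K)"
    and B: "B = {poly p lam + poly q lam * mu | p q. p \<in> polys_over (emb ` K) \<and> q \<in> polys_over (emb ` K)}"
  shows "F = {x / y | x y. x \<in> B \<and> y \<in> B \<and> y \<noteq> 0}"
proof -
  have "eval2 emb lam mu ` polys_over (polys_over K) = B"
  proof (intro equalityI subsetI)
    fix x assume "x \<in> eval2 emb lam mu ` polys_over (polys_over K)"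
    then show "x \<in> B"
      using eval2_reduce[OF _ assms(1)] unfolding B by blast
  next
    fix x assume "x \<in> B"
    then obtain p q where "p \<in> polys_over (emb ` K)" "q \<in> polys_over (emb ` K)"
      and x: "x = poly p lam + poly q lam * mu"
      unfolding B by blast
    then obtain p' q' where "p' \<in> polys_over K" "p = map_poly emb p'"
      "q' \<in> polys_over K" "q = map_poly emb q'"
      by (metis polys_over_image_E)
    then have "x = eval2 emb lam mu [:p', q':]" "[:p', q':] \<in> polys_over (polys_over K)"
      using pair_in_polys_over by (auto simp: x eval2_pCons eval2_0 mult.commute)
    then show "x \<in> eval2 emb lam mu ` polys_over (polys_over K)"
      by blast
  qed
  then show ?thesis
    using curve unfolding curve_function_field_def by blast
qed

end

end

theorem theorem4p11:
  fixes d :: "'a::field_char_0 \<Rightarrow> 'a"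
    and u :: 'a and s :: nat and L A R :: "'a poly" and K :: "'a set"
    and D :: "'e::field_char_0 \<Rightarrow> 'e"
    and emb :: "'a \<Rightarrow> 'e" and lam mu \<phi> \<Psi> :: 'e and F :: "'e set"
  assumes "derivation d"
    and "algebraically_closed_on (constants d)"
    and "u \<notin> constants d"
    and "L = schroedinger u"
    and "algebro_geometric d L"
    and "partner d L s A R"
    and "K = differential_subfield d hull (insert u (constants d))"
    and "curve_function_field K (spectral_poly R) emb lam mu F"
    and "derivation D"
    and "\<forall>x\<in>K. D (emb x) = emb (d x)"
    and "D lam = 0" and "D mu = 0"
    and "differential_closure D F"
    and "\<phi> \<in> F"
    and "monic_gcrd D F [:- \<phi>, 1:] (map_poly emb L - [:lam:]) (map_poly emb A - [:mu:])"
    and "\<Psi> \<noteq> 0"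
    and "dop_apply D (map_poly emb L - [:lam:]) \<Psi> = 0"
    and "D \<Psi> = \<phi> * \<Psi>"
  shows "transcendental_over F \<Psi> \<and>
    constants D \<inter> (differential_subfield D hull (insert \<Psi> F)) = constants D \<inter> F"
proof -
  note D = assms(9)
  have K: "differential_subfield d K"
    unfolding assms(7) by (rule differential_subfield_hull)
  have KC: "insert u (constants d) \<subseteq> K"
    unfolding assms(7) by (rule hull_subset)
  have R: "R \<in> polys_over (constants d)" "degree R = 2 * s + 1"
    using assms(6) by (auto simp: partner_def)
  then have RK: "R \<in> polys_over K"
    using KC by (auto simp: polys_over_def)
  have hom: "field_hom_on K emb"
    using assms(8) by (simp add: curve_function_field_def)
  have k: "differential_subfield D (emb ` K)"
    using differential_subfield_image[OF K hom assms(10)] .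
  interpret odd_curve D "emb ` K" "map_poly emb R" lam mu
  proof
    show "map_poly emb R \<in> polys_over (emb ` K)"
      by (rule map_emb_in_polys_over[OF K hom RK])
    show "odd (degree (map_poly emb R))"
      by (simp add: degree_map_emb[OF K hom RK] R)
    show "mu\<^sup>2 + poly (map_poly emb R) lam = 0"
      by (rule spectral_curve_equation[OF K hom assms(8) RK])
  qed (use assms k spectral_coordinates_unique[OF K hom assms(8) RK] in auto)
  have F_eq: "F = {x / y | x y. x \<in> B \<and> y \<in> B \<and> y \<noteq> 0}"
    by (rule function_field_quotients[OF K hom assms(8) RK k]) (simp add: B_def coord_def)
  have F: "differential_subfield D F"
    using assms(13) by (simp add: differential_closure_def)
  \<comment> \<open>The operator equation for \<open>\<Psi>\<close> becomes a Riccati equation for its logarithmic derivative \<open>\<phi>\<close>.\<close>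
  have "map_poly emb L - [:lam:] = [:emb u - lam, 0, -1:]"
    using emb_0[OF K hom] emb_hom(1)[OF K hom] emb_minus[OF K hom, of 1]
      differential_subfield_closed(2)[OF K]
    by (simp add: assms(4) schroedinger_def map_poly_pCons)
  then have "(emb u - lam) * \<Psi> - D (D \<Psi>) = 0"
    using assms(17) by (simp add: dop_apply_def numeral_2_eq_2)
  then have "(D \<phi> + \<phi>\<^sup>2) * \<Psi> = (emb u - lam) * \<Psi>"
    by (simp add: assms(18) derivation_mult[OF D] power2_eq_square algebra_simps)
  then have riccati: "D \<phi> + \<phi>\<^sup>2 = emb u - lam"
    using assms(16) by simp
  have no_exp: "a = 0" if "a \<in> F" "m > 0" "D a = of_nat m * \<phi> * a" for a m
    using no_exponential_of_riccati_solution[OF F_eq assms(14) _ riccati that] KC by blast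
  show ?thesis
  proof
    show "transcendental_over F \<Psi>"
      by (rule exponential_transcendental[OF D F assms(14) _ assms(16,18)]) (rule no_exp)
    show "constants D \<inter> (differential_subfield D hull (insert \<Psi> F)) = constants D \<inter> F"
      by (rule exponential_no_new_constants[OF D F assms(14) _ assms(16,18)]) (rule no_exp)
  qed
qed

end
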